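(* Let $k\geq 4$ and $0\leq \alpha\leq k-2$ be integers. Let $A$ be a set of $k$ positive integers such that \[|\Sigma_{\alpha}(A)|=\frac{k(k+1)}{2}-\frac{\alpha(\alpha+1)}{2}+1.\] Then $A=d*[1,k]$ for some positive integer $d$.
   Context: For a finite set $A$ of integers with $|A|=k$ and an integer $0\leq\alpha\leq k$, $\Sigma_{\alpha}(A)=\{s(B): B\subseteq A,\ |B|\geq \alpha\}$, where $s(B)=\sum_{b\in B} b$ and $s(\emptyset)=0$. For integers $a\leq b$, $[a,b]=\{a,a+1,\ldots,b\}$, and for an integer $d$ and a set $X$, $d*X=\{dx: x\in X\}$. *)

theory Defs
  imports Complex_Main
begin

definition subset_sums_ge :: "nat \<Rightarrow> int set \<Rightarrow> int set"
  where "subset_sums_ge \<alpha> A = {\<Sum>B | B. B \<subseteq> A \<and> \<alpha> \<le> card B}"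

definition dilate :: "int \<Rightarrow> int set \<Rightarrow> int set"
  where "dilate d X = {d * x | x. x \<in> X}"

end

theory Submission
  imports Defs
begin

text \<open>
  Passing to complements, the sums of at least \<open>\<alpha>\<close> elements become the sums of at most
  \<open>m = k - \<alpha> \<ge> 2\<close> elements. With \<open>M\<close> the maximum of \<open>A\<close> and \<open>A' = A - {M}\<close>, these contain
  the disjoint sets \<open>{0} \<union> A'\<close> and \<open>M +\<close> (sums of at most \<open>m - 1\<close> elements of \<open>A'\<close>), which gives
  the lower bound by induction. Equality forces every sum of two distinct elements of \<open>A\<close> to lie in
  \<open>A \<union> (M + A')\<close>. Applied to sums with the minimum \<open>a\<close>, this makes \<open>A - {a}\<close> an arithmetic
  progression with difference \<open>a\<close>; applied to the sum of its least element \<open>b\<close> and its second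
  largest element, it gives \<open>b = 2a\<close>.
\<close>

section \<open>Sums of at most \<open>m\<close> elements and complements\<close>

definition subset_sums_le :: "nat \<Rightarrow> int set \<Rightarrow> int set"
  where "subset_sums_le m A = {\<Sum>B | B. B \<subseteq> A \<and> card B \<le> m}"

lemma finite_subset_sums_le: "finite A \<Longrightarrow> finite (subset_sums_le m A)"
  by (rule finite_subset[of _ "Sum ` Pow A"]) (auto simp: subset_sums_le_def)

lemma subset_sums_leI: "B \<subseteq> A \<Longrightarrow> card B \<le> m \<Longrightarrow> \<Sum>B \<in> subset_sums_le m A"
  by (auto simp: subset_sums_le_def)

lemma subset_sums_le_nonneg:
  assumes "\<forall>a\<in>A. 0 < a" "x \<in> subset_sums_le m A"
  shows "0 \<le> x"
  using assms by (force simp: subset_sums_le_def intro!: sum_nonneg)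

text \<open>Replacing \<open>B\<close> by \<open>A - B\<close> turns a sum \<open>x\<close> into
  \<open>\<Sum>A - x\<close>, and this reflection is injective.\<close>

lemma card_subset_sums_ge_eq:
  assumes "finite A" "\<alpha> \<le> card A"
  shows "card (subset_sums_ge \<alpha> A) = card (subset_sums_le (card A - \<alpha>) A)"
proof -
  have compl: "\<Sum>(A - B) = \<Sum>A - \<Sum>B" if "B \<subseteq> A" for B
    using assms(1) that by (rule sum_diff)
  have cardc: "card (A - B) = card A - card B" "card B \<le> card A" if "B \<subseteq> A" for B
    using assms(1) that by (auto simp: card_Diff_subset finite_subset card_mono)
  have "subset_sums_ge \<alpha> A = (\<lambda>x. \<Sum>A - x) ` subset_sums_le (card A - \<alpha>) A" (is "?L = ?R")
  proof
    show "?L \<subseteq> ?R"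
    proof
      fix x assume "x \<in> ?L"
      then obtain B where B: "B \<subseteq> A" "\<alpha> \<le> card B" "x = \<Sum>B"
        by (auto simp: subset_sums_ge_def)
      have "\<Sum>(A - B) \<in> subset_sums_le (card A - \<alpha>) A"
        using B cardc[of B] by (intro subset_sums_leI) auto
      then show "x \<in> ?R" using B compl[of B] by (intro image_eqI[of _ _ "\<Sum>(A - B)"]) auto
    qed
    show "?R \<subseteq> ?L"
    proof
      fix x assume "x \<in> ?R"
      then obtain B where B: "B \<subseteq> A" "card B \<le> card A - \<alpha>" "x = \<Sum>A - \<Sum>B"
        by (auto simp: subset_sums_le_def)
      then show "x \<in> ?L" using compl[of B] cardc[of B] assms(2)
        unfolding subset_sums_ge_def by (intro CollectI exI[of _ "A - B"]) auto
    qed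
  qed
  then show ?thesis by (simp add: card_image inj_on_def)
qed

section \<open>Splitting off the maximum; the lower bound\<close>

text \<open>The two pieces of \<open>P\<close> are disjoint because the first lies strictly below
  \<open>Max A\<close>, while the second is a translate by \<open>Max A\<close> of nonnegative
  sums.\<close>

lemma subset_sums_le_Max_split:
  fixes m :: nat and A :: "int set"
  assumes fin: "finite A" and ne: "A \<noteq> {}" and pos: "\<forall>a\<in>A. 0 < a"
  defines "P \<equiv> insert 0 (A - {Max A}) \<union> (+) (Max A) ` subset_sums_le m (A - {Max A})"
  shows "P \<subseteq> subset_sums_le (Suc m) A"
    and "card P = card A + card (subset_sums_le m (A - {Max A}))"
proof -
  let ?M = "Max A" and ?A' = "A - {Max A}"
  have M: "?M \<in> A" using fin ne by simp
  have "x \<in> subset_sums_le (Suc m) A" if "x \<in> insert 0 A" for x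
    using that subset_sums_leI[of "{}" A "Suc m"] subset_sums_leI[of "{x}" A "Suc m"] by auto
  moreover have "?M + x \<in> subset_sums_le (Suc m) A" if x: "x \<in> subset_sums_le m ?A'" for x
  proof -
    obtain B where B: "B \<subseteq> ?A'" "card B \<le> m" "x = \<Sum>B"
      using x by (auto simp: subset_sums_le_def)
    then have "finite B" "?M \<notin> B" using fin by (auto intro: finite_subset)
    then show ?thesis
      using B M subset_sums_leI[of "insert ?M B" A "Suc m"] by auto
  qed
  ultimately show "P \<subseteq> subset_sums_le (Suc m) A" unfolding P_def by auto
  have low: "x < ?M" if "x \<in> insert 0 ?A'" for x
    using that M pos Max_ge[OF fin, of x] by (auto simp: order.strict_iff_order)
  have high: "?M \<le> x" if "x \<in> (+) ?M ` subset_sums_le m ?A'" for x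
    using that subset_sums_le_nonneg[of ?A' _ m] pos by auto
  have "insert 0 ?A' \<inter> (+) ?M ` subset_sums_le m ?A' = {}"
    using low high by force
  then have "card P = card (insert 0 ?A') + card ((+) ?M ` subset_sums_le m ?A')"
    unfolding P_def using fin finite_subset_sums_le[of ?A' m] by (intro card_Un_disjoint) auto
  \<comment> \<open>Since 0 is not in \<open>A\<close>, it makes up for the removed maximum.\<close>
  also have "card (insert 0 ?A') = card A"
    using fin pos M card_Suc_Diff1[OF fin M] by (subst card_insert_disjoint) auto
  finally show "card P = card A + card (subset_sums_le m ?A')"
    by (simp add: card_image)
qed

text \<open>The extremal value \<open>k + (k-1) + \<dots> + (k-m+1) + 1\<close>, doubled and free of subtractions.\<close>

lemma card_subset_sums_le_lower:
  assumes "finite A" "\<forall>a\<in>A. 0 < a" "m \<le> card A"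
  shows "card A * (card A + 1) + 2
    \<le> 2 * card (subset_sums_le m A) + (card A - m) * (card A - m + 1)"
  using assms
proof (induction m arbitrary: A)
  case 0
  have "0 \<in> subset_sums_le 0 A" using subset_sums_leI[of "{}" A 0] by simp
  then have "1 \<le> card (subset_sums_le 0 A)"
    using finite_subset_sums_le[OF 0(1), of 0] by (auto simp: Suc_le_eq card_gt_0_iff)
  then show ?case by simp
next
  case (Suc m)
  let ?A' = "A - {Max A}"
  have ne: "A \<noteq> {}" using Suc.prems by auto
  then have c: "card A = Suc (card ?A')"
    using Suc.prems(1) by (metis Max_in card_Suc_Diff1)
  have "card A + card (subset_sums_le m ?A') \<le> card (subset_sums_le (Suc m) A)"
    using subset_sums_le_Max_split[OF Suc.prems(1) ne Suc.prems(2), of m]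
      finite_subset_sums_le[OF Suc.prems(1), of "Suc m"] card_mono by metis
  moreover have "card ?A' * (card ?A' + 1) + 2
      \<le> 2 * card (subset_sums_le m ?A') + (card ?A' - m) * (card ?A' - m + 1)"
    using Suc.prems c by (intro Suc.IH) auto
  \<comment> \<open>The main term grows by \<open>2 * card A\<close>, twice the gain from the split,
    and the correction term is unchanged because
    \<open>card A - Suc m = card ?A' - m\<close>.\<close>
  ultimately show ?case unfolding c by simp
qed

section \<open>The case of equality\<close>

text \<open>The split inclusion and the lower bound for \<open>A'\<close> together give exactly the
  lower bound for \<open>A\<close>, so equality for \<open>A\<close> forces equality in both. As
  \<open>A'\<close> is again extremal, the lemma can be iterated.\<close>

lemma card_subset_sums_le_minimal_split:
  fixes m :: nat and A :: "int set"
  assumes fin: "finite A" and pos: "\<forall>a\<in>A. 0 < a" and m: "Suc m \<le> card A"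
    and eq: "2 * card (subset_sums_le (Suc m) A) + (card A - Suc m) * (card A - Suc m + 1)
      = card A * (card A + 1) + 2"
  defines "A' \<equiv> A - {Max A}"
  shows "subset_sums_le (Suc m) A = insert 0 A' \<union> (+) (Max A) ` subset_sums_le m A'"
    and "2 * card (subset_sums_le m A') + (card A' - m) * (card A' - m + 1)
      = card A' * (card A' + 1) + 2"
    and "card A = Suc (card A')"
proof -
  have ne: "A \<noteq> {}" using m by auto
  then show c: "card A = Suc (card A')"
    using fin unfolding A'_def by (metis Max_in card_Suc_Diff1)
  let ?P = "insert 0 A' \<union> (+) (Max A) ` subset_sums_le m A'"
  note split = subset_sums_le_Max_split[OF fin ne pos, of m, folded A'_def]
  note finS = finite_subset_sums_le[OF fin, of "Suc m"]
  have low: "card A' * (card A' + 1) + 2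
      \<le> 2 * card (subset_sums_le m A') + (card A' - m) * (card A' - m + 1)"
    using fin pos m c by (intro card_subset_sums_le_lower) (auto simp: A'_def)
  have le: "card A + card (subset_sums_le m A') \<le> card (subset_sums_le (Suc m) A)"
    using split finS card_mono by metis
  show "2 * card (subset_sums_le m A') + (card A' - m) * (card A' - m + 1)
      = card A' * (card A' + 1) + 2"
    using low le eq unfolding c by simp
  then have "card ?P = card (subset_sums_le (Suc m) A)"
    using split(2) eq unfolding c by simp
  then show "subset_sums_le (Suc m) A = ?P"
    using card_subset_eq[OF finS split(1)] by simp
qed

text \<open>Two splits, possible as \<open>m\<close> is at least 2, put \<open>x + y\<close> into
  \<open>A'\<close>, \<open>{M}\<close>, \<open>M + A''\<close> or \<open>M + M' + z\<close> with
  \<open>z\<close> a nonnegative sum. In the last case the bound \<open>x + y \<le> M + M'\<close>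
  forces \<open>z = 0\<close>.\<close>

lemma pair_sums_of_minimal:
  assumes fin: "finite A" and pos: "\<forall>a\<in>A. 0 < a" and m: "2 \<le> m" "m \<le> card A"
    and eq: "2 * card (subset_sums_le m A) + (card A - m) * (card A - m + 1)
      = card A * (card A + 1) + 2"
    and xy: "x \<in> A" "y \<in> A" "x \<noteq> y"
  shows "x + y \<in> A \<union> (+) (Max A) ` (A - {Max A})"
proof -
  define M A' where "M = Max A" and "A' = A - {M}"
  define M' A'' where "M' = Max A'" and "A'' = A' - {M'}"
  obtain n where n: "m = Suc (Suc n)" using m(1) by (metis Suc_le_D numeral_2_eq_2 Suc_le_mono)
  have A: "subset_sums_le m A = insert 0 A' \<union> (+) M ` subset_sums_le (Suc n) A'"
    and eq': "2 * card (subset_sums_le (Suc n) A') + (card A' - Suc n) * (card A' - Suc n + 1)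
      = card A' * (card A' + 1) + 2"
    and c: "card A = Suc (card A')"
    using card_subset_sums_le_minimal_split[of A "Suc n"] fin pos m(2) eq
    unfolding n M_def A'_def by auto
  have fin': "finite A'" and pos': "\<forall>a\<in>A'. 0 < a"
    using fin pos by (auto simp: A'_def)
  have A': "subset_sums_le (Suc n) A' = insert 0 A'' \<union> (+) M' ` subset_sums_le n A''"
    using card_subset_sums_le_minimal_split(1)[OF fin' pos' _ eq'] m(2) c
    unfolding n M'_def A''_def by auto
  have ne': "A' \<noteq> {}" using m(2) c n by auto
  then have M': "M' \<in> A'" using fin' by (simp add: M'_def)
  have M: "M \<in> A" using Max_in[OF fin] xy(1) by (auto simp: M_def)
  have "x + y \<in> subset_sums_le m A"
    using subset_sums_leI[of "{x, y}" A m] xy m by auto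
  moreover have "x + y \<noteq> 0" using xy pos add_pos_pos[of x y] by auto
  \<comment> \<open>As \<open>x\<close> and \<open>y\<close> differ, at most one of them is
    \<open>M\<close>; any other element is at most \<open>M'\<close>.\<close>
  moreover have ub: "x + y \<le> M + M'"
  proof -
    have *: "u \<le> M" "u \<noteq> M \<Longrightarrow> u \<le> M'" if "u \<in> A" for u
      using that fin fin' by (auto simp: M_def M'_def A'_def)
    show ?thesis using *[OF xy(1)] *[OF xy(2)] xy(3) by (cases "x = M") auto
  qed
  moreover have "0 \<le> z" if "z \<in> subset_sums_le n A''" for z
    using subset_sums_le_nonneg[OF _ that] pos' by (auto simp: A''_def)
  ultimately have "x + y \<in> A' \<or> x + y = M \<or> x + y \<in> (+) M ` A'"
    using M' unfolding A A' A''_def by (force simp: image_iff)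
  then show ?thesis using M by (auto simp: A'_def M_def)
qed

section \<open>Recovering the progression\<close>

text \<open>Subtracting \<open>a\<close> repeatedly stays in \<open>A\<close> until it reaches
  \<open>a\<close>, and positivity makes it stop. So each element is a multiple of \<open>a\<close>
  with all smaller positive multiples in \<open>A\<close>; the maximum then determines
  \<open>A\<close>.\<close>

lemma eq_dilate_if_closed_under_diff:
  assumes fin: "finite A" and pos: "\<forall>x\<in>A. 0 < x" and ne: "A \<noteq> {}"
    and closed: "\<And>x. x \<in> A \<Longrightarrow> x \<noteq> a \<Longrightarrow> x - a \<in> A" and a: "0 < a"
  shows "A = dilate a {1..int (card A)}"
proof -
  have initial: "\<exists>n::nat. x = a * int n \<and> 0 < n \<and> (\<forall>i\<in>{1..n}. a * int i \<in> A)" if "x \<in> A" for x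
    using that
  proof (induction "nat x" arbitrary: x rule: less_induct)
    case less
    show ?case
    proof (cases "x = a")
      case True
      then show ?thesis using less.prems by (intro exI[of _ 1]) auto
    next
      case False
      then have "x - a \<in> A" using closed less.prems by blast
      moreover have "nat (x - a) < nat x" using a pos less.prems by auto
      ultimately obtain n :: nat where n: "x - a = a * int n" "0 < n" "\<forall>i\<in>{1..n}. a * int i \<in> A"
        using less.hyps by blast
      have x: "x = a * int (Suc n)" using n(1) by (simp add: algebra_simps)
      have "a * int i \<in> A" if "i \<in> {1..Suc n}" for i
        using that n(3) x less.prems by (cases "i = Suc n") auto
      then show ?thesis using x by blast
    qed
  qed
  obtain n :: nat where n: "Max A = a * int n" "\<forall>i\<in>{1..n}. a * int i \<in> A"
    using initial[OF Max_in[OF fin ne]] by blast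
  have "A = (\<lambda>i. a * int i) ` {1..n}"
  proof
    show "A \<subseteq> (\<lambda>i. a * int i) ` {1..n}"
    proof
      fix x assume x: "x \<in> A"
      then obtain j :: nat where j: "x = a * int j" "0 < j" using initial by blast
      have "x \<le> Max A" using fin x by simp
      then have "j \<le> n" using a by (simp add: j n(1))
      then show "x \<in> (\<lambda>i. a * int i) ` {1..n}" using j by auto
    qed
  qed (use n in auto)
  moreover from this have "card A = n"
    using a by (simp add: card_image inj_on_def)
  ultimately have "A = (\<lambda>i. a * int i) ` {1..card A}" by simp
  also have "\<dots> = (*) a ` int ` {1..card A}" by (simp add: image_image)
  also have "int ` {1..card A} = {1..int (card A)}" by (simp add: image_int_atLeastAtMost)
  also have "(*) a ` {1..int (card A)} = dilate a {1..int (card A)}" by (auto simp: dilate_def)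
  finally show ?thesis .
qed

text \<open>The aim is closure under subtracting \<open>a = Min A\<close>. With at least four
  elements, the set \<open>B\<close> of non-extreme ones has distinct minimum \<open>b\<close> and
  maximum \<open>c\<close>.\<close>

lemma dilate_if_pair_sums:
  assumes fin: "finite A" and pos: "\<forall>a\<in>A. 0 < a" and k: "4 \<le> card A"
    and pair: "\<And>x y. x \<in> A \<Longrightarrow> y \<in> A \<Longrightarrow> x \<noteq> y
      \<Longrightarrow> x + y \<in> A \<union> (+) (Max A) ` (A - {Max A})"
  shows "A = dilate (Min A) {1..int (card A)}"
proof -
  define a M where "a = Min A" and "M = Max A"
  define B where "B = A - {a, M}"
  define b c where "b = Min B" and "c = Max B"
  have ne: "A \<noteq> {}" using k by auto
  have aA: "a \<in> A" and MA: "M \<in> A" and amin: "\<And>x. x \<in> A \<Longrightarrow> a \<le> x"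
    and Mmax: "\<And>x. x \<in> A \<Longrightarrow> x \<le> M"
    using fin ne by (auto simp: a_def M_def)
  have a0: "0 < a" using aA pos by blast
  have finB: "finite B" using fin by (simp add: B_def)
  have "card {a, M} \<le> 2" by (simp add: card_insert_if)
  then have cB: "2 \<le> card B"
    using k diff_card_le_card_Diff[of "{a, M}" A] by (simp add: B_def)
  then have neB: "B \<noteq> {}" by auto
  have bB: "b \<in> B" and cB': "c \<in> B" and bmin: "\<And>x. x \<in> B \<Longrightarrow> b \<le> x"
    and cmax: "\<And>x. x \<in> B \<Longrightarrow> x \<le> c"
    using finB neB by (auto simp: b_def c_def)
  have bc: "b \<noteq> c"
  proof
    assume "b = c"
    then have "B \<subseteq> {b}" using bmin cmax by force
    then show False using cB card_mono[of "{b}" B] by simp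
  qed
  \<comment> \<open>Otherwise \<open>a + x = M + z\<close> with \<open>z \<ge> a\<close>,
    contradicting \<open>x < M\<close>.\<close>
  have shift: "a + x \<in> A" if "x \<in> B" for x
  proof (rule ccontr)
    assume "a + x \<notin> A"
    moreover have "x \<in> A" "x \<noteq> a" "x < M" using that Mmax[of x] by (auto simp: B_def)
    ultimately obtain z where "z \<in> A" "a + x = M + z"
      using pair[OF aA, of x] by (auto simp: M_def)
    then show False using amin[of z] \<open>x < M\<close> by simp
  qed
  have aM: "a < M" using bB amin[of b] Mmax[of b] by (auto simp: B_def)
  \<comment> \<open>The translate avoids \<open>a\<close> and \<open>b\<close>, and both sides have
    \<open>card A - 2\<close> elements.\<close>
  have image: "(+) a ` B = A - {a, b}"
  proof (rule card_subset_eq)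
    have "a + x \<noteq> b" "a + x \<noteq> a" if "x \<in> B" for x
      using bmin[OF that] a0 pos that by (auto simp: B_def)
    then show "(+) a ` B \<subseteq> A - {a, b}" using shift by auto
    have "card (A - {a, b}) = card A - 2"
      using aA bB fin by (subst card_Diff_subset) (auto simp: B_def card_insert_if)
    moreover have "card B = card A - 2"
      unfolding B_def using aA MA aM fin by (subst card_Diff_subset) auto
    ultimately show "card ((+) a ` B) = card (A - {a, b})" by (simp add: card_image)
  qed (use fin in auto)
  have backshift: "x - a \<in> A" if "x \<in> A" "x \<noteq> a" "x \<noteq> b" for x
  proof -
    have "x \<in> (+) a ` B" using image that by blast
    then show ?thesis by (auto simp: B_def)
  qed
  \<comment> \<open>\<open>a + c\<close> lies in \<open>A\<close> above both \<open>a\<close> and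
    \<open>c\<close>, so it can only be \<open>M\<close>.\<close>
  have acM: "a + c = M"
    using shift[OF cB'] cmax[of "a + c"] a0 pos cB' by (force simp: B_def)
  \<comment> \<open>This is the case left open by \<open>backshift\<close>. As \<open>b + c\<close>
    exceeds \<open>a + c = M\<close>, it must be \<open>M + z\<close> with \<open>z\<close> in
    \<open>A\<close>, and then \<open>z = b - a\<close>.\<close>
  have "b - a \<in> A"
  proof -
    have bA: "b \<in> A" "c \<in> A" "a < b"
      using bB cB' amin[of b] by (auto simp: B_def)
    then have "b + c \<notin> A" using Mmax[of "b + c"] acM by auto
    then obtain z where z: "z \<in> A" "z \<noteq> M" "b + c = M + z"
      using pair[of b c] bA bc by (auto simp: M_def)
    then have "z = b - a" using acM by simp
    then show ?thesis using z by simp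
  qed
  then have "A = dilate a {1..int (card A)}"
    using backshift a0 by (intro eq_dilate_if_closed_under_diff[OF fin pos ne]) blast+
  then show ?thesis by (simp add: a_def)
qed

theorem theorem2p2:
  fixes k \<alpha> :: nat and A :: "int set"
  assumes "4 \<le> k"
    and "\<alpha> \<le> k - 2"
    and "finite A"
    and "card A = k"
    and "\<forall>a\<in>A. 0 < a"
    and "real (card (subset_sums_ge \<alpha> A)) =
      real k * (real k + 1) / 2 - real \<alpha> * (real \<alpha> + 1) / 2 + 1"
  shows "\<exists>d::int. 0 < d \<and> A = dilate d {1..int k}"
proof -
  have \<alpha>: "k - (k - \<alpha>) = \<alpha>" "\<alpha> \<le> card A" using assms(1,2,4) by auto
  \<comment> \<open>Doubling and moving the subtracted term across lets the equation pass from reals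
    to naturals.\<close>
  have "real (2 * card (subset_sums_ge \<alpha> A) + \<alpha> * (\<alpha> + 1)) = real (k * (k + 1) + 2)"
    using assms(6) by (simp add: field_simps)
  then have "2 * card (subset_sums_ge \<alpha> A) + \<alpha> * (\<alpha> + 1) = k * (k + 1) + 2"
    using of_nat_eq_iff by blast
  then have eq: "2 * card (subset_sums_le (k - \<alpha>) A) + (card A - (k - \<alpha>)) * (card A - (k - \<alpha>) + 1)
      = card A * (card A + 1) + 2"
    using card_subset_sums_ge_eq[OF assms(3) \<alpha>(2)] \<alpha>(1) assms(4) by simp
  have "2 \<le> k - \<alpha>" "k - \<alpha> \<le> card A" using assms(1,2,4) by auto
  from pair_sums_of_minimal[OF assms(3,5) this eq]
  have "A = dilate (Min A) {1..int (card A)}"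
    using dilate_if_pair_sums assms(1,3,4,5) by blast
  moreover have "0 < Min A"
  proof -
    have "A \<noteq> {}" using assms(1,4) by auto
    then show ?thesis using assms(3,5) by simp
  qed
  ultimately show ?thesis using assms(4) by blast
qed

end
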